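(* Let $f\in\mathcal{A}$, $f(z)=z+\sum_{n=2}^{\infty}a_nz^n$. Then $f\in\mathcal{G}_{sh}$ if and only if for every $\theta\in[0,2\pi)$ and every $z\in\mathbb{D}$, $$\frac{1}{z}\left(f(z)\ast\frac{z-\beta_\theta z^{2}}{(1-z)^{2}}\right)\neq 0,\qquad\text{where}\quad \beta_\theta=\frac{1+\sinh(e^{i\theta})}{\sinh(e^{i\theta})}.$$
   Context: $\mathbb{D}=\{z\in\mathbb{C}:|z|<1\}$. $\mathcal{A}$ is the class of analytic functions on $\mathbb{D}$ of the form $f(z)=z+\sum_{n=2}^\infty a_nz^n$. Subordination: $f_1\prec f_2$ means there is a Schwarz function $\omega$ (analytic on $\mathbb{D}$, $|\omega(z)|\le|z|$) with $f_1(z)=f_2(\omega(z))$ for $z\in\mathbb{D}$. The class $\mathcal{G}_{sh}$ is $$\mathcal{G}_{sh}=\left\{f\in\mathcal{A}:\frac{zf'(z)}{f(z)}-1\prec\sinh(z)\right\}.$$ The convolution (Hadamard product) of $f(z)=z+\sum_{n\ge2}a_nz^n$ and $g(z)=z+\sum_{n\ge2}b_nz^n$ is $(f\ast g)(z)=z+\sum_{n\ge2}a_nb_nz^n$. The expression $\frac1z(\cdot)$ is understood at $z=0$ by its removable-singularity value. *)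

theory Defs
  imports "HOL-Complex_Analysis.Complex_Analysis"
begin

text \<open>
  Functions on the unit disc are total functions on the complex numbers of which only the
  values on \<open>ball 0 1\<close> matter. Derivatives and Taylor coefficients are taken at interior
  points, so they do not depend on the values outside the disc.
\<close>

definition class_A :: "(complex \<Rightarrow> complex) set" where
  "class_A = {f. f holomorphic_on ball 0 1 \<and>
     (\<exists>a :: nat \<Rightarrow> complex. \<forall>z\<in>ball 0 1. (\<lambda>n. a (n + 2) * z ^ (n + 2)) sums (f z - z))}"

definition schwarz_function :: "(complex \<Rightarrow> complex) \<Rightarrow> bool" where
  "schwarz_function \<omega> \<longleftrightarrow> \<omega> holomorphic_on ball 0 1 \<and> (\<forall>z\<in>ball 0 1. norm (\<omega> z) \<le> norm z)"

definition subordinate :: "(complex \<Rightarrow> complex) \<Rightarrow> (complex \<Rightarrow> complex) \<Rightarrow> bool" where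
  "subordinate f1 f2 \<longleftrightarrow> (\<exists>\<omega>. schwarz_function \<omega> \<and> (\<forall>z\<in>ball 0 1. f1 z = f2 (\<omega> z)))"

text \<open>
  For \<open>f\<close> in \<open>class_A\<close>, the quotient \<open>z f'(z) / f(z)\<close> has a removable singularity at 0 with
  value 1, which \<open>remove_sings\<close> fills in. At any other zero of \<open>f\<close> in the disc it has a pole;
  such an \<open>f\<close> is not in the class, because the quotient is unbounded near the pole, whereas
  \<open>sinh \<circ> \<omega>\<close> is bounded (so the value that HOL assigns at the pole itself is irrelevant).
\<close>

definition G_sh :: "(complex \<Rightarrow> complex) set" where
  "G_sh = {f \<in> class_A. subordinate (remove_sings (\<lambda>z. z * deriv f z / f z - 1)) sinh}"

text \<open>
  The coefficients of \<open>f\<close> and \<open>g\<close> are their Taylor coefficients at 0. The product is meant for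
  functions whose expansion starts with \<open>z\<close>.
\<close>

definition hadamard :: "(complex \<Rightarrow> complex) \<Rightarrow> (complex \<Rightarrow> complex) \<Rightarrow> complex \<Rightarrow> complex" where
  "hadamard f g z =
     z + (\<Sum>n. fps_nth (fps_expansion f 0) (n + 2) * fps_nth (fps_expansion g 0) (n + 2) * z ^ (n + 2))"

definition beta :: "real \<Rightarrow> complex" where
  "beta \<theta> = (1 + sinh (exp (\<i> * of_real \<theta>))) / sinh (exp (\<i> * of_real \<theta>))"

end

theory Submission
  imports Defs
begin

text \<open>
  The convolution with \<open>(z - \<beta> z\<^sup>2) / (1 - z)\<^sup>2\<close> is \<open>z f' - \<beta> (z f' - f)\<close>. Hence the
  condition says that \<open>f'\<close> and \<open>(1 + sinh \<zeta>) f / z\<close> never agree for \<open>\<bar>\<zeta>\<bar> = 1\<close>, that is,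
  the meromorphic function \<open>z f' / f - 1\<close> avoids the curve that is the image of the unit circle
  under \<open>sinh\<close>. As \<open>sinh\<close> is injective on the closed unit disc, a subordinate function avoids
  this curve. Conversely, the points whose value lies in the image of the open disc form a subset
  of the disc that is open, closed (closedness is where the curve has to be avoided) and contains
  0. So all values lie there, and composing with the inverse of \<open>sinh\<close> gives a self-map of the
  disc that fixes 0, to which the Schwarz lemma applies.
\<close>

section \<open>Injectivity of the hyperbolic sine on the closed unit disc\<close>

lemma inj_on_sinh_cball: "inj_on sinh (cball (0 :: complex) 1)"
proof (rule inj_onI)
  fix x y :: complex
  assume "x \<in> cball 0 1" "y \<in> cball 0 1" and eq: "sinh x = sinh y"
  then have im: "\<bar>Im x\<bar> \<le> 1" "\<bar>Im y\<bar> \<le> 1"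
    using abs_Im_le_cmod[of x] abs_Im_le_cmod[of y] by auto
  have "exp x - exp (- x) = exp y - exp (- y)"
    using eq unfolding sinh_field_def divide_cancel_right by simp
  moreover have "exp x * exp (- x) = 1" "exp y * exp (- y) = 1"
    by (simp_all flip: exp_add)
  \<comment> \<open>The difference of the two sides factors. The first factor gives x = y and the
    second x + y = \<i> * pi, both modulo 2 * pi * \<i>; the bounds on the imaginary parts exclude
    all but x = y.\<close>
  ultimately have "(exp x - exp y) * (1 + exp (- x) * exp (- y)) = 0"
    by algebra
  then consider "exp x = exp y" | "exp (- x) * exp (- y) = - 1"
    by (auto simp: add_eq_0_iff)
  then show "x = y"
  proof cases
    case 1
    moreover have "\<bar>Im x - Im y\<bar> < 2 * pi"
      using im pi_gt3 by linarith
    ultimately show ?thesis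
      by (rule exp_complex_eqI[rotated])
  next
    case 2
    then have "exp (- x - y) = exp (\<i> * pi)"
      using exp_add[of "- x" "- y"] by simp
    moreover have "\<bar>Im (- x - y) - Im (\<i> * pi)\<bar> < 2 * pi"
      using im pi_gt3 by simp
    ultimately have "- x - y = \<i> * pi"
      by (rule exp_complex_eqI[rotated])
    then have "Im (- x - y) = pi"
      by (metis Im_i_times Re_complex_of_real)
    then show ?thesis
      using im pi_gt3 by auto
  qed
qed

lemma sinh_eq_iff_cball:
  fixes x y :: complex
  assumes "norm x \<le> 1" "norm y \<le> 1"
  shows "sinh x = sinh y \<longleftrightarrow> x = y"
  using inj_on_eq_iff[OF inj_on_sinh_cball] assms by auto

section \<open>Taylor coefficients and the convolution with the kernel\<close>

lemma class_A_normalized: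
  assumes "f \<in> class_A"
  shows "f holomorphic_on ball 0 1" "f 0 = 0" "deriv f 0 = 1"
proof -
  show hol: "f holomorphic_on ball 0 1"
    using assms by (simp add: class_A_def)
  obtain a :: "nat \<Rightarrow> complex" where
    a: "\<And>z. z \<in> ball 0 1 \<Longrightarrow> (\<lambda>n. a (n + 2) * z ^ (n + 2)) sums (f z - z)"
    using assms unfolding class_A_def by blast
  \<comment> \<open>The series in \<open>class_A\<close> starts at index 2, so \<open>a 0\<close>
    and \<open>a 1\<close> are arbitrary; \<open>b\<close> puts the true coefficients 0 and 1 in
    their place. Uniqueness of the expansion then yields the normalization.\<close>
  define b where "b n = (if n = 0 then 0 else if n = 1 then 1 else a n)" for n
  have "(\<lambda>n. b n * z ^ n) sums f z" if "z \<in> ball 0 1" for z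
  proof -
    have "(\<lambda>n. b (n + 2) * z ^ (n + 2)) sums (f z - z)"
      using a[OF that] by (simp add: b_def)
    then show ?thesis
      by (subst (asm) sums_iff_shift) (simp add: b_def numeral_2_eq_2)
  qed
  then have "f has_fps_expansion Abs_fps b"
    by (intro has_fps_expansionI eventually_mono[OF eventually_nhds_in_open[of "ball 0 1"]]) auto
  then have "fps_expansion f 0 = Abs_fps b"
    by (rule fps_expansion_eqI)
  then have "fps_nth (fps_expansion f 0) n = b n" for n
    by simp
  from this[of 0] this[of 1] show "f 0 = 0" "deriv f 0 = 1"
    by (simp_all add: fps_expansion_def b_def)
qed

lemma fps_nth_expansion_koebe:
  fixes c :: complex
  shows "fps_nth (fps_expansion (\<lambda>u. (u - c * u ^ 2) / (1 - u) ^ 2) 0) (n + 2) =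
    of_nat (n + 2) - c * of_nat (n + 1)"
proof -
  define b where "b n = (if n = 0 then 0 else of_nat n - c * of_nat (n - 1))" for n
  have "(\<lambda>n. b n * u ^ n) sums ((u - c * u ^ 2) / (1 - u) ^ 2)" if "u \<in> ball 0 1" for u
  proof -
    have s: "(\<lambda>n. of_nat (Suc n) * u ^ n) sums (1 / (1 - u) ^ 2)"
      using that by (intro geometric_deriv_sums) auto
    have "(\<lambda>n. of_nat n * u ^ n) sums (u * (1 / (1 - u) ^ 2))"
      using sums_mult[OF s, of u] by (intro sums_Suc_imp[of "\<lambda>n. of_nat n * u ^ n"]) (simp_all add: mult_ac)
    \<comment> \<open>Truncated subtraction makes the coefficients at 0 and 1 both vanish, so the
      series may be shifted by 2.\<close>
    moreover have "(\<lambda>n. of_nat (n - 1) * u ^ n) sums (u ^ 2 * (1 / (1 - u) ^ 2))"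
    proof (rule sums_zero_iff_shift[of 2, THEN iffD1])
      show "(\<lambda>n. of_nat (n + 2 - 1) * u ^ (n + 2)) sums (u ^ 2 * (1 / (1 - u) ^ 2))"
        using sums_mult[OF s, of "u ^ 2"] by (simp add: power2_eq_square mult_ac del: of_nat_Suc)
    qed (auto simp: less_2_cases_iff)
    ultimately have "(\<lambda>n. of_nat n * u ^ n - c * (of_nat (n - 1) * u ^ n)) sums
        (u * (1 / (1 - u) ^ 2) - c * (u ^ 2 * (1 / (1 - u) ^ 2)))"
      by (intro sums_diff sums_mult)
    moreover have "(\<lambda>n. of_nat n * u ^ n - c * (of_nat (n - 1) * u ^ n)) = (\<lambda>n. b n * u ^ n)"
      by (auto simp: b_def algebra_simps)
    ultimately show ?thesis
      by (simp add: diff_divide_distrib)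
  qed
  then have "(\<lambda>u. (u - c * u ^ 2) / (1 - u) ^ 2) has_fps_expansion Abs_fps b"
    by (intro has_fps_expansionI eventually_mono[OF eventually_nhds_in_open[of "ball 0 1"]]) auto
  from fps_expansion_eqI[OF this] show ?thesis
    by (simp add: b_def)
qed

text \<open>Multiplying the n-th coefficient by n turns f into z f'. The kernel has the coefficients
  n - c (n - 1), so it acts as z f' - c (z f' - f).\<close>

lemma hadamard_koebe:
  assumes "f \<in> class_A" "z \<in> ball 0 1"
  shows "hadamard f (\<lambda>u. (u - c * u ^ 2) / (1 - u) ^ 2) z =
    z * deriv f z - c * (z * deriv f z - f z)"
proof -
  note f = class_A_normalized[OF assms(1)]
  define b where "b n = fps_nth (fps_expansion f 0) n" for n
  have b01: "b 0 = 0" "b 1 = 1"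
    using f by (simp_all add: b_def fps_expansion_def)
  have sf: "(\<lambda>n. b n * z ^ n) sums f z"
    using holomorphic_power_series[OF f(1) assms(2)] by (simp add: b_def fps_expansion_def)
  have "deriv f holomorphic_on ball 0 1"
    using f(1) by (intro holomorphic_deriv) auto
  from holomorphic_power_series[OF this assms(2)]
  have "(\<lambda>n. (deriv ^^ n) (deriv f) 0 / fact n * z ^ n) sums deriv f z"
    by simp
  moreover have "(deriv ^^ n) (deriv f) 0 / fact n = of_nat (Suc n) * b (Suc n)" for n
    by (simp add: b_def fps_expansion_def funpow_swap1 del: of_nat_Suc)
  ultimately have "(\<lambda>n. z * (of_nat (Suc n) * b (Suc n) * z ^ n)) sums (z * deriv f z)"
    by (intro sums_mult) (simp del: of_nat_Suc)
  then have sd: "(\<lambda>n. of_nat n * b n * z ^ n) sums (z * deriv f z)"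
    by (intro sums_Suc_imp[of "\<lambda>n. of_nat n * b n * z ^ n"]) (simp_all add: mult_ac)
  have "(\<lambda>n. of_nat n * b n * z ^ n - c * (of_nat n * b n * z ^ n - b n * z ^ n)) sums
      (z * deriv f z - c * (z * deriv f z - f z))"
    by (intro sums_diff sums_mult sd sf)
  \<comment> \<open>The terms of index 0 and 1 are 0 and z; \<open>hadamard\<close> carries this z
    as a separate summand.\<close>
  then have "(\<lambda>n. of_nat (n + 2) * b (n + 2) * z ^ (n + 2)
        - c * (of_nat (n + 2) * b (n + 2) * z ^ (n + 2) - b (n + 2) * z ^ (n + 2))) sums
      (z * deriv f z - c * (z * deriv f z - f z) - z)"
    by (subst sums_iff_shift) (simp add: b01[simplified] numeral_2_eq_2)
  moreover have "of_nat (n + 2) * b (n + 2) * z ^ (n + 2)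
        - c * (of_nat (n + 2) * b (n + 2) * z ^ (n + 2) - b (n + 2) * z ^ (n + 2)) =
      b (n + 2) * (of_nat (n + 2) - c * of_nat (n + 1)) * z ^ (n + 2)" for n
    by (simp add: algebra_simps)
  ultimately show ?thesis
    unfolding hadamard_def fps_nth_expansion_koebe b_def[symmetric]
    by (simp add: sums_iff)
qed

section \<open>Removable singularities and the reformulation of the convolution condition\<close>

definition div_id :: "(complex \<Rightarrow> complex) \<Rightarrow> complex \<Rightarrow> complex" where
  "div_id f z = (if z = 0 then 1 else f z / z)"

lemma holomorphic_div_id:
  assumes "f \<in> class_A"
  shows "div_id f holomorphic_on ball 0 1"
proof -
  note f = class_A_normalized[OF assms]
  \<comment> \<open>The difference quotient at 0 extends by \<open>deriv f 0\<close>, which is the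
    value 1 chosen in \<open>div_id\<close>.\<close>
  have "(\<lambda>z. if z = 0 then deriv f 0 else (f z - f 0) / (z - 0)) holomorphic_on ball 0 1"
    using f by (intro pole_lemma) auto
  then show ?thesis
    by (simp add: f div_id_def[abs_def] cong: if_cong)
qed

lemma remove_sings_eq_continuous:
  assumes "continuous_on (ball 0 1) g" "\<And>w. w \<in> ball 0 1 - {0} \<Longrightarrow> h w = g w"
    and "z \<in> ball 0 1"
  shows "remove_sings h z = g z"
proof (rule remove_sings_eqI)
  have "g \<midarrow>z\<rightarrow> g z"
    using assms by (metis continuous_on_def at_within_open open_ball)
  moreover have "eventually (\<lambda>w. w \<in> ball 0 1 - {0} - {z}) (at z)"
  proof (cases "z = 0")
    case True
    then show ?thesis
      using eventually_at_in_open[of "ball 0 1" z] by simp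
  next
    case False
    then show ?thesis
      using assms(3) by (intro eventually_at_in_open) auto
  qed
  then have "eventually (\<lambda>w. g w = h w) (at z)"
    by eventually_elim (use assms(2) in auto)
  ultimately show "h \<midarrow>z\<rightarrow> g z"
    by (rule Lim_transform_eventually)
qed

lemma remove_sings_hadamard_koebe:
  assumes "f \<in> class_A" "z \<in> ball 0 1"
  shows "remove_sings (\<lambda>w. 1 / w * hadamard f (\<lambda>u. (u - c * u ^ 2) / (1 - u) ^ 2) w) z =
    deriv f z - c * (deriv f z - div_id f z)"
proof (rule remove_sings_eq_continuous[OF _ _ assms(2)])
  show "continuous_on (ball 0 1) (\<lambda>z. deriv f z - c * (deriv f z - div_id f z))"
    using class_A_normalized(1)[OF assms(1)] holomorphic_div_id[OF assms(1)]
    by (intro holomorphic_on_imp_continuous_on holomorphic_intros) auto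
  show "1 / w * hadamard f (\<lambda>u. (u - c * u ^ 2) / (1 - u) ^ 2) w =
      deriv f w - c * (deriv f w - div_id f w)" if "w \<in> ball 0 1 - {0}" for w
    using that hadamard_koebe[OF assms(1), of w c] by (simp add: div_id_def field_simps)
qed

text \<open>With s = sinh \<zeta> and \<beta> = (1 + s) / s, multiplying f' - \<beta> (f' - f/z) = 0
  by s leaves f' = (1 + s) f/z. This product form stays meaningful at zeros of
  \<open>div_id f\<close>.\<close>

lemma convolution_condition_iff:
  assumes "f \<in> class_A"
  shows "(\<forall>\<theta>\<in>{0..<2 * pi}. \<forall>z\<in>ball 0 1.
      remove_sings (\<lambda>w. 1 / w * hadamard f (\<lambda>u. (u - beta \<theta> * u ^ 2) / (1 - u) ^ 2) w) z \<noteq> 0) \<longleftrightarrow>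
    (\<forall>\<zeta>\<in>sphere 0 1. \<forall>z\<in>ball 0 1. deriv f z \<noteq> (1 + sinh \<zeta>) * div_id f z)"
    (is "?L \<longleftrightarrow> ?R")
proof -
  have eq: "remove_sings (\<lambda>w. 1 / w * hadamard f (\<lambda>u. (u - beta \<theta> * u ^ 2) / (1 - u) ^ 2) w) z = 0 \<longleftrightarrow>
      deriv f z = (1 + sinh (exp (\<i> * of_real \<theta>))) * div_id f z" if "z \<in> ball 0 1" for \<theta> z
  proof -
    \<comment> \<open>Injectivity on the closed disc: 0 is the only zero of sinh there, so the
      denominator of \<open>beta\<close> does not vanish.\<close>
    have "sinh (exp (\<i> * of_real \<theta>)) \<noteq> 0"
      using sinh_eq_iff_cball[of "exp (\<i> * of_real \<theta>)" 0] by simp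
    then show ?thesis
      unfolding remove_sings_hadamard_koebe[OF assms that] beta_def
      by (auto simp: field_simps)
  qed
  have "sphere 0 1 = (\<lambda>\<theta>. exp (\<i> * of_real \<theta>)) ` {0..<2 * pi}"
  proof (intro equalityI subsetI)
    fix \<zeta> :: complex assume "\<zeta> \<in> sphere 0 1"
    then show "\<zeta> \<in> (\<lambda>\<theta>. exp (\<i> * of_real \<theta>)) ` {0..<2 * pi}"
      using complex_norm_eq_1_exp[of \<zeta>] Arg2pi[of \<zeta>] by (intro image_eqI[of _ _ "Arg2pi \<zeta>"]) auto
  qed auto
  then show ?thesis
    using eq by auto
qed

section \<open>Members of the class avoid the boundary curve\<close>

lemma no_zero_if_logderiv_bounded:
  assumes f: "f holomorphic_on ball 0 1" "deriv f 0 \<noteq> 0" and z: "z \<in> ball 0 1"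
    and g: "isCont g z" "eventually (\<lambda>w. deriv f w / f w = g w) (at z)"
  shows "f z \<noteq> 0"
proof
  assume 0: "f z = 0"
  have ana: "f analytic_on {z}"
    using f(1) z by (meson analytic_at open_ball)
  have lau: "(\<lambda>w. f (z + w)) has_laurent_expansion fps_to_fls (fps_expansion f z)"
    using analytic_at_imp_has_fps_expansion[OF ana] by (rule has_laurent_expansion_fps)
  \<comment> \<open>Otherwise f would vanish on the whole disc by the identity theorem, against
    \<open>deriv f 0 \<noteq> 0\<close>.\<close>
  have "fps_expansion f z \<noteq> 0"
  proof
    assume *: "fps_expansion f z = 0"
    have "(deriv ^^ n) f z = 0" for n
      using arg_cong[OF *, of "\<lambda>F. fps_nth F n"] by (simp add: fps_expansion_def)
    then have "f w = 0" if "w \<in> ball 0 1" for w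
      using holomorphic_fun_eq_0_on_connected[OF f(1) _ _ _ z that] by auto
    then have "eventually (\<lambda>w. f w = 0) (nhds 0)"
      by (intro eventually_mono[OF eventually_nhds_in_open[of "ball 0 1"]]) auto
    from deriv_cong_ev[OF this refl] show False
      using f(2) by simp
  qed
  \<comment> \<open>At a zero of f the logarithmic derivative has a pole, which is incompatible with
    the finite limit \<open>g z\<close>.\<close>
  then have "is_pole (\<lambda>w. deriv f w / f w) z \<longleftrightarrow> is_pole f z \<or> f \<midarrow>z\<rightarrow> 0"
    by (intro is_pole_deriv_divide_iff[OF lau]) auto
  moreover have "f \<midarrow>z\<rightarrow> 0"
    using analytic_at_imp_isCont[OF ana] 0 by (metis isContD)
  moreover have "(\<lambda>w. deriv f w / f w) \<midarrow>z\<rightarrow> g z"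
    using g by (auto simp: isCont_def tendsto_cong)
  ultimately show False
    unfolding is_pole_def by (metis at_neq_bot not_tendsto_and_filterlim_at_infinity)
qed

lemma remove_sings_G_sh:
  assumes "f \<in> class_A" "z \<in> ball 0 1" "div_id f z \<noteq> 0"
  shows "remove_sings (\<lambda>z. z * deriv f z / f z - 1) z = deriv f z / div_id f z - 1"
proof (rule remove_sings_eqI)
  note f = class_A_normalized[OF assms(1)]
  have "(\<lambda>z. deriv f z / div_id f z - 1) analytic_on {z}"
  proof -
    have "deriv f analytic_on {z}" "div_id f analytic_on {z}"
      using f(1) holomorphic_div_id[OF assms(1)] assms(2)
      by (meson analytic_at holomorphic_deriv open_ball)+
    then show ?thesis
      using assms(3) by (intro analytic_on_diff analytic_on_divide analytic_on_const) auto
  qed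
  then have "(\<lambda>z. deriv f z / div_id f z - 1) \<midarrow>z\<rightarrow> deriv f z / div_id f z - 1"
    by (metis (no_types, lifting) analytic_at_imp_isCont isContD)
  moreover have "eventually (\<lambda>w. w \<noteq> 0) (at z)"
    by (cases "z = 0") (auto simp: eventually_neq_at_within)
  then have "eventually (\<lambda>w. deriv f w / div_id f w - 1 = w * deriv f w / f w - 1) (at z)"
    by eventually_elim (auto simp: div_id_def)
  ultimately show "(\<lambda>z. z * deriv f z / f z - 1) \<midarrow>z\<rightarrow> deriv f z / div_id f z - 1"
    by (rule Lim_transform_eventually)
qed

lemma G_sh_imp_avoids:
  assumes "f \<in> G_sh" and \<zeta>: "\<zeta> \<in> sphere 0 1" and z: "z \<in> ball 0 1"
  shows "deriv f z \<noteq> (1 + sinh \<zeta>) * div_id f z"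
proof -
  have fA: "f \<in> class_A"
    using assms by (simp add: G_sh_def)
  note f = class_A_normalized[OF fA]
  obtain \<omega> where \<omega>: "\<omega> holomorphic_on ball 0 1" "\<And>z. z \<in> ball 0 1 \<Longrightarrow> norm (\<omega> z) \<le> norm z"
    "\<And>z. z \<in> ball 0 1 \<Longrightarrow> remove_sings (\<lambda>z. z * deriv f z / f z - 1) z = sinh (\<omega> z)"
    using assms(1) by (auto simp: G_sh_def subordinate_def schwarz_function_def)
  have ana: "f analytic_on {z}"
    using f(1) z by (meson analytic_at open_ball)
  \<comment> \<open>Away from 0, subordination makes f' / f agree near z with the analytic function
    (1 + sinh (\<omega> w)) / w, so f cannot vanish at z.\<close>
  have nz: "div_id f z \<noteq> 0"
  proof (cases "z = 0")
    case False
    have sub: "\<forall>\<^sub>F w in at z. w \<in> ball 0 1 - {0} - {z}"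
      using z False by (intro eventually_at_in_open) auto
    \<comment> \<open>This ensures that \<open>remove_sings\<close> leaves the quotient unchanged on
      a punctured neighbourhood of z.\<close>
    have "isolated_singularity_at (\<lambda>z. z * deriv f z / f z - 1) z"
    proof (rule meromorphic_on_isolated_singularity)
      have "f meromorphic_on {z}" "deriv f meromorphic_on {z}"
        using ana by (auto intro: analytic_on_imp_meromorphic_on analytic_deriv)
      then show "(\<lambda>z. z * deriv f z / f z - 1) meromorphic_on {z}"
        by (intro meromorphic_intros)
    qed
    from eventually_remove_sings_eq_at[OF this] sub
    have "\<forall>\<^sub>F w in at z. deriv f w / f w = (1 + sinh (\<omega> w)) / w"
      by eventually_elim (use \<omega>(3) in \<open>auto simp: field_simps\<close>)
    moreover have "(\<lambda>w. (1 + sinh (\<omega> w)) / w) analytic_on {z}"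
    proof (rule analytic_at[THEN iffD2], intro exI conjI)
      show "(\<lambda>w. (1 + sinh (\<omega> w)) / w) holomorphic_on ball 0 1 - {0}"
        unfolding sinh_field_def using \<omega>(1)
        by (intro holomorphic_intros) auto
    qed (use z False in auto)
    ultimately have "f z \<noteq> 0"
      using f(3) by (intro no_zero_if_logderiv_bounded[OF f(1) _ z analytic_at_imp_isCont]) auto
    with False show ?thesis
      by (simp add: div_id_def)
  qed (simp add: div_id_def)
  have "deriv f z / div_id f z - 1 = sinh (\<omega> z)"
    using remove_sings_G_sh[OF fA z nz] \<omega>(3)[OF z] by (rule trans[OF sym])
  moreover have "norm (\<omega> z) < 1"
    using \<omega>(2)[OF z] z by simp
  then have "sinh (\<omega> z) \<noteq> sinh \<zeta>"
    using \<zeta> sinh_eq_iff_cball[of "\<omega> z" \<zeta>] by auto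
  ultimately show ?thesis
    using nz by auto
qed

section \<open>Avoiding the boundary curve implies membership\<close>

lemma avoids_imp_G_sh:
  assumes fA: "f \<in> class_A"
    and av: "\<And>\<zeta> z. \<zeta> \<in> sphere 0 1 \<Longrightarrow> z \<in> ball 0 1 \<Longrightarrow> deriv f z \<noteq> (1 + sinh \<zeta>) * div_id f z"
  shows "f \<in> G_sh"
proof -
  note f = class_A_normalized[OF fA]
  define q where "q z = deriv f z / div_id f z - 1" for z
  define V where "V = {z \<in> ball 0 1. div_id f z \<noteq> 0}"
  have hol: "deriv f holomorphic_on ball 0 1" "div_id f holomorphic_on ball 0 1"
    using f(1) by (auto intro: holomorphic_deriv holomorphic_div_id[OF fA])
  note cont = hol[THEN holomorphic_on_imp_continuous_on]
  have hol_sinh: "sinh holomorphic_on ball (0 :: complex) 1"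
    by (auto simp: holomorphic_on_def field_differentiable_def intro!: derivative_eq_intros)
  have inj: "inj_on sinh (ball (0 :: complex) 1)"
    by (rule inj_on_subset[OF inj_on_sinh_cball]) auto
  have V_eq: "V = ball 0 1 \<inter> div_id f -` (- {0})"
    by (auto simp: V_def)
  have open_V: "open V"
    unfolding V_eq using cont by (intro continuous_open_preimage) auto
  have qV: "q holomorphic_on V"
    unfolding q_def
    by (intro holomorphic_on_diff holomorphic_on_divide holomorphic_on_const
        hol[THEN holomorphic_on_subset]) (auto simp: V_def)
  define S where "S = V \<inter> q -` sinh ` ball 0 1"
  \<comment> \<open>S becomes a projection along the compact closed disc, so closedness of the set
    of pairs passes to S. Allowing \<zeta> on the unit circle adds no points, by
    \<open>av\<close>.\<close>
  have S_eq: "S = {z. \<exists>\<zeta>. \<zeta> \<in> cball 0 1 \<and> (\<zeta>, z) \<in>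
      {p \<in> cball 0 1 \<times> ball 0 1. deriv f (snd p) - (1 + sinh (fst p)) * div_id f (snd p) = 0}}"
    (is "S = {z. \<exists>\<zeta>. \<zeta> \<in> cball 0 1 \<and> (\<zeta>, z) \<in> ?U}")
  proof (intro equalityI subsetI)
    fix z assume "z \<in> S"
    then obtain \<zeta> where \<zeta>: "z \<in> ball 0 1" "div_id f z \<noteq> 0" "norm \<zeta> < 1" "q z = sinh \<zeta>"
      by (auto simp: S_def V_def)
    then have "deriv f z - (1 + sinh \<zeta>) * div_id f z = 0"
      by (auto simp: q_def field_simps)
    then show "z \<in> {z. \<exists>\<zeta>. \<zeta> \<in> cball 0 1 \<and> (\<zeta>, z) \<in> ?U}"
      using \<zeta> by (auto intro!: exI[of _ \<zeta>])
  next
    fix z assume "z \<in> {z. \<exists>\<zeta>. \<zeta> \<in> cball 0 1 \<and> (\<zeta>, z) \<in> ?U}"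
    then obtain \<zeta> where \<zeta>: "norm \<zeta> \<le> 1" "z \<in> ball 0 1" "deriv f z = (1 + sinh \<zeta>) * div_id f z"
      by auto
    \<comment> \<open>If \<open>div_id f z\<close> were 0, the equation would force
      \<open>deriv f z = 0\<close>, and then it would also hold for \<zeta> = 1 on the
      circle.\<close>
    have nz: "div_id f z \<noteq> 0"
      using av[of 1 z] \<zeta> by auto
    have "norm \<zeta> \<noteq> 1"
      using av[of \<zeta> z] \<zeta> by auto
    then have "\<zeta> \<in> ball 0 1"
      using \<zeta> by auto
    moreover have "q z = sinh \<zeta>"
      using \<zeta> nz by (simp add: q_def)
    ultimately show "z \<in> S"
      using nz \<zeta> by (auto simp: S_def V_def)
  qed
  \<comment> \<open>An injective holomorphic map is open, so S is the preimage of an open set under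
    q, which is continuous on the open set V.\<close>
  have "open S"
    unfolding S_def
    by (intro continuous_open_preimage open_V holomorphic_on_imp_continuous_on[OF qV]
        open_mapping_thm3[OF hol_sinh _ inj]) auto
  then have "openin (top_of_set (ball 0 1)) S"
    by (intro open_openin_trans) (auto simp: S_def V_def)
  moreover have "closedin (top_of_set (ball 0 1)) S"
    unfolding S_eq
  proof (rule closedin_compact_projection)
    show "closedin (top_of_set (cball 0 1 \<times> ball 0 1)) ?U"
      by (intro continuous_closedin_preimage_constant continuous_intros
          continuous_on_compose2[OF cont(1)] continuous_on_compose2[OF cont(2)]) auto
  qed auto
  moreover have "0 \<in> S"
    using f by (auto simp: S_def V_def q_def div_id_def intro!: image_eqI[of _ _ 0])
  ultimately have S: "S = ball 0 1"
    using connected_ball[of "0 :: complex" 1] by (auto simp: connected_clopen)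
  have all: "div_id f z \<noteq> 0 \<and> q z \<in> sinh ` ball 0 1" if "z \<in> ball 0 1" for z
  proof -
    have "z \<in> S"
      using that S by simp
    then show ?thesis
      by (simp add: S_def V_def)
  qed
  obtain g where g: "g holomorphic_on sinh ` ball (0 :: complex) 1"
      "\<And>z. z \<in> ball 0 1 \<Longrightarrow> g (sinh z) = z"
    by (rule holomorphic_has_inverse[OF hol_sinh open_ball inj]) (rule that)
  \<comment> \<open>Since S is the whole disc, q takes all its values in the domain of the inverse g
    of sinh.\<close>
  define \<omega> where "\<omega> = g \<circ> q"
  have sinh_\<omega>: "sinh (\<omega> z) = q z" "norm (\<omega> z) < 1" if "z \<in> ball 0 1" for z
    using all[OF that] g(2) by (auto simp: \<omega>_def)
  have "V = ball 0 1"
    using all by (auto simp: V_def)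
  with qV have "q holomorphic_on ball 0 1" by simp
  then have hol\<omega>: "\<omega> holomorphic_on ball 0 1"
    unfolding \<omega>_def using all by (intro holomorphic_on_compose_gen[OF _ g(1)]) auto
  have "q 0 = 0"
    by (simp add: q_def div_id_def f)
  then have \<omega>0: "\<omega> 0 = 0"
    using g(2)[of 0] by (simp add: \<omega>_def)
  have "norm (\<omega> z) \<le> norm z" if "z \<in> ball 0 1" for z
    using that sinh_\<omega> by (intro Schwarz_Lemma(1)[OF hol\<omega> \<omega>0]) auto
  then have "schwarz_function \<omega>"
    using hol\<omega> by (simp add: schwarz_function_def)
  moreover have "remove_sings (\<lambda>z. z * deriv f z / f z - 1) z = sinh (\<omega> z)" if "z \<in> ball 0 1" for z
    using remove_sings_G_sh[OF fA that] all[OF that] sinh_\<omega>(1)[OF that] by (simp add: q_def)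
  ultimately show ?thesis
    using fA by (auto simp: G_sh_def subordinate_def)
qed

theorem theorem2:
  fixes f :: "complex \<Rightarrow> complex"
  assumes "f \<in> class_A"
  shows "f \<in> G_sh \<longleftrightarrow>
    (\<forall>\<theta>\<in>{0..<2 * pi}. \<forall>z\<in>ball 0 1.
       remove_sings (\<lambda>w. 1 / w * hadamard f (\<lambda>u. (u - beta \<theta> * u ^ 2) / (1 - u) ^ 2) w) z \<noteq> 0)"
  unfolding convolution_condition_iff[OF assms]
  using G_sh_imp_avoids avoids_imp_G_sh[OF assms] by blast

end
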